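(* Let $\mathcal{L}^{1}$ and $\mathcal{L}^{2}$ be two labels such that $\mathcal{L}^{1}$ dominates $\mathcal{L}^{2}$. Let $e=\{v_{s_{1}},\ldots,v_{s_{l}}\}$, $l\geq 0$, $s_{i}\in\{1,\ldots,N\}$, be some (possibly empty) ng-feasible extension to $\mathcal{L}^{2}$. Then: (i) the route $\{v_{0}\}\oplus e\oplus\mathcal{L}^{1}.pr$ is ng-feasible; and (ii) its reduced cost is not greater than the reduced cost of the route $\{v_{0}\}\oplus e\oplus\mathcal{L}^{2}.pr$.
   Context: Setting. There are $N+1$ nodes: a depot $v_0$ and customers $v_1,\ldots,v_N$. The demand of customer $v_i$ is a random variable $D_i$ with values in the non-negative integers, probability mass function $p_{D_i}$ and finite mean $E[D_i]$; demands are independent. $d_{ij}\ge 0$ ($i,j\in\{0,\ldots,N\}$, $d_{ii}=0$) is the transportation cost from $v_i$ to $v_j$; the triangle inequality $d_{ij}\le d_{ik}+d_{kj}$ holds (symmetry is not assumed). The vehicle capacity $Q$ is a positive integer and the load factor $f$ is a positive real. For an integer $k\ge 0$ and $q\in\{0,\ldots,Q\}$, let $\Psi(k,q)=\max\{0,\lceil (k-q)/Q\rceil\}$ (number of replenishment trips needed to serve demand $k$ with remaining quantity $q$); note $Q\Psi(k,q)+q-k\in\{0,\ldots,Q\}$. Dual values. $\alpha_0=0$; $\alpha_1,\ldots,\alpha_N\in\mathbb{R}$; sets $S_1,\ldots,S_C\subseteq\{v_1,\ldots,v_N\}$ with values $\beta_1,\ldots,\beta_C\ge 0$ (dual values of partitioning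 constraints and rounded capacity cuts). For $i,j\in\{0,\ldots,N\}$, $\gamma_{ij}=-\alpha_j-\sum_{k=1}^{C}\beta_k[v_i\in S_k,\,v_j\notin S_k]$, where $[\cdot]$ is $1$ if the condition holds and $0$ otherwise. ng-sets. For each customer $v_i$ a set $\eta_i$ of customers with $v_i\in\eta_i$ is fixed. Labels. A label $\mathcal{L}$ has attributes: $n$ (index of current customer), $rl$ (remaining load), $pr$ (partial route, a finite sequence of nodes ending in $v_0$), $ap$ (a priori cost of $pr$), $\nu(q)$ for $q\in\{0,\ldots,Q\}$ (expected remaining route cost), $\Gamma$ (cumulative dual contribution) and $ng$ (set of customers to which a backward extension is forbidden). Write $\oplus$ for concatenation of sequences. The root label of customer $v_j$ (with $E[D_j]\le fQ$) has $n=j$, $rl=fQ-E[D_j]$, $pr=\{v_j,v_0\}$, $ap=d_{j0}$, $\nu(q)=d_{j0}$ for all $q$, $\Gamma=\gamma_{j0}$, $ng=\{v_j\}$. The (backward) extension of $\mathcal{L}$ to a single customer $v_i$ is the label $\mathcal{E}$ with $\mathcal{E}.n=i$, $\mathcal{E}.rl=\mathcal{L}.rl-E[D_i]$, $\mathcal{E}.pr=\{v_i\}\oplus\mathcal{L}.pr$, $\mathcal{E}.ap=\mathcal{L}.ap+d_{i\mathcal{L}.n}$, $\mathcal{E}.\Gamma=\mathcal{L}.\Gamma+\gamma_{i\mathcal{L}.n}$, $\mathcal{E}.ng=(\mathcal{L}.ng\cap\eta_i)\cup\{v_i\}$ and, writing $m=\mathcal{L}.n$, for $q\in\{0,\ldots,Q\}$,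 $$\mathcal{E}.\nu(q)=\min\Bigl\{d_{im}+\sum_{k=0}^{\infty}\bigl[(d_{m0}+d_{0m})\Psi(k,q)+\mathcal{L}.\nu(Q\Psi(k,q)+q-k)\bigr]p_{D_m}(k),\ \ d_{i0}+d_{0m}+\sum_{k=0}^{\infty}\bigl[(d_{m0}+d_{0m})\Psi(k,Q)+\mathcal{L}.\nu(Q\Psi(k,Q)+Q-k)\bigr]p_{D_m}(k)\Bigr\}.$$ This single-customer extension is ng-feasible if $\mathcal{L}.rl\ge E[D_i]$ and $v_i\notin\mathcal{L}.ng$. The extension of $\mathcal{L}$ to a sequence $e=\{v_{s_1},\ldots,v_{s_l}\}$ is obtained by successive single-customer extensions to $v_{s_l},v_{s_{l-1}},\ldots,v_{s_1}$ in this order, so that its partial route is $e\oplus\mathcal{L}.pr$; $e$ is an ng-feasible extension to $\mathcal{L}$ if each of these steps is ng-feasible (the empty extension always is, and leaves $\mathcal{L}$ unchanged). Labels are the root labels and everything obtained from them by ng-feasible extensions. A route $\{v_0\}\oplus P$ is ng-feasible if $P$ is the partial route of such a label. Reduced cost. For a label $\mathcal{L}$ with $m=\mathcal{L}.n$, the reduced cost of the route $\{v_0\}\oplus\mathcal{L}.pr$ is $$\phi(\{v_0\}\oplus\mathcal{L}.pr)=d_{0m}+\sum_{k=0}^{\infty}\bigl[(d_{m0}+d_{0m})\Psi(k,Q)+\mathcal{L}.\nu(Q\Psi(k,Q)+Q-k)\bigr]p_{D_m}(k)+\mathcal{L}.\Gamma+\gamma_{0m}.$$ Dominance. For labels with $\mathcal{L}^{1}.n=\mathcal{L}^{2}.n$,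 $\mathcal{L}^{1}$ dominates $\mathcal{L}^{2}$ if $\mathcal{L}^{1}.rl\geq\mathcal{L}^{2}.rl$, $\mathcal{L}^{1}.ng\subseteq\mathcal{L}^{2}.ng$, $\mathcal{L}^{1}.\Gamma\leq\mathcal{L}^{2}.\Gamma$, and $\mathcal{L}^{1}.\nu(q)\leq\mathcal{L}^{2}.\nu(q)$ for all $q\in\{0,\ldots,Q\}$. *)

theory Defs
  imports "HOL-Probability.Probability"
begin

text \<open>
  The depot \<open>v\<^sub>0\<close> and the customers \<open>v\<^sub>1, \<dots>, v\<^sub>N\<close> are represented by their indices
  \<open>0, 1, \<dots>, N\<close>. Functions indexed by nodes or cuts are meaningful only on \<open>{0..N}\<close>,
  \<open>{1..N}\<close> or \<open>{1..C}\<close> respectively; nothing is assumed about other arguments.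
\<close>

record 'w vrpsd_data =
  num_customers :: nat
  prob_sp :: "'w measure"
  demand :: "nat \<Rightarrow> 'w \<Rightarrow> nat"
  cost :: "nat \<Rightarrow> nat \<Rightarrow> real"
  capacity :: nat
  load_factor :: real
  alpha_dual :: "nat \<Rightarrow> real"
  num_cuts :: nat
  cut_set :: "nat \<Rightarrow> nat set"
  beta_dual :: "nat \<Rightarrow> real"
  ng_neighbours :: "nat \<Rightarrow> nat set"

definition customers :: "'w vrpsd_data \<Rightarrow> nat set" where
  "customers I = {1..num_customers I}"

locale vrpsd = prob_space "prob_sp I" for I :: "'w vrpsd_data" +
  assumes demand_indep: "indep_vars (\<lambda>_. count_space UNIV) (demand I) (customers I)"
    and demand_integrable: "\<And>i. i \<in> customers I \<Longrightarrow> integrable (prob_sp I) (\<lambda>\<omega>. real (demand I i \<omega>))"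
    and cost_nonneg: "\<And>i j. i \<le> num_customers I \<Longrightarrow> j \<le> num_customers I \<Longrightarrow> 0 \<le> cost I i j"
    and cost_diag: "\<And>i. i \<le> num_customers I \<Longrightarrow> cost I i i = 0"
    and cost_triangle: "\<And>i j k. i \<le> num_customers I \<Longrightarrow> j \<le> num_customers I \<Longrightarrow> k \<le> num_customers I \<Longrightarrow>
          cost I i j \<le> cost I i k + cost I k j"
    and capacity_pos: "0 < capacity I"
    and load_factor_pos: "0 < load_factor I"
    and alpha_depot: "alpha_dual I 0 = 0"
    and cut_set_subset: "\<And>c. c \<in> {1..num_cuts I} \<Longrightarrow> cut_set I c \<subseteq> customers I"
    and beta_nonneg: "\<And>c. c \<in> {1..num_cuts I} \<Longrightarrow> 0 \<le> beta_dual I c"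
    and ng_neighbours_subset: "\<And>i. i \<in> customers I \<Longrightarrow> ng_neighbours I i \<subseteq> customers I"
    and ng_neighbours_self: "\<And>i. i \<in> customers I \<Longrightarrow> i \<in> ng_neighbours I i"

definition demand_pmf :: "'w vrpsd_data \<Rightarrow> nat \<Rightarrow> nat \<Rightarrow> real" where
  "demand_pmf I i k = measure (prob_sp I) {\<omega> \<in> space (prob_sp I). demand I i \<omega> = k}"

definition mean_demand :: "'w vrpsd_data \<Rightarrow> nat \<Rightarrow> real" where
  "mean_demand I i = (\<integral>\<omega>. real (demand I i \<omega>) \<partial>prob_sp I)"

definition replenishments :: "'w vrpsd_data \<Rightarrow> nat \<Rightarrow> nat \<Rightarrow> nat" where
  "replenishments I k q = nat (max 0 \<lceil>(real k - real q) / real (capacity I)\<rceil>)"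

definition gamma_dual :: "'w vrpsd_data \<Rightarrow> nat \<Rightarrow> nat \<Rightarrow> real" where
  "gamma_dual I i j =
     - alpha_dual I j
     - (\<Sum>c = 1..num_cuts I. beta_dual I c * (if i \<in> cut_set I c \<and> j \<notin> cut_set I c then 1 else 0))"

text \<open>
  The load left after serving demand \<open>k\<close>. The truncated subtraction is harmless, see
  \<open>remaining_load_exact\<close> below.
\<close>

definition remaining_load :: "'w vrpsd_data \<Rightarrow> nat \<Rightarrow> nat \<Rightarrow> nat" where
  "remaining_load I k q = capacity I * replenishments I k q + q - k"

lemma remaining_load_exact:
  assumes "0 < capacity I" "q \<le> capacity I"
  shows "k \<le> capacity I * replenishments I k q + q"
    and "remaining_load I k q \<le> capacity I"
proof -
  let ?Q = "real (capacity I)" and ?x = "(real k - real q) / real (capacity I)"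
  have Q: "0 < ?Q" using assms by simp
  have psi: "real (replenishments I k q) = max 0 (of_int \<lceil>?x\<rceil>)"
    unfolding replenishments_def by (simp add: max_def)
  have x: "?Q * ?x = real k - real q" using Q by simp
  have "?x \<le> real (replenishments I k q)" using psi by linarith
  then have "?Q * ?x \<le> ?Q * real (replenishments I k q)" using Q by (intro mult_left_mono) auto
  then have "real k \<le> real (capacity I * replenishments I k q + q)" using x by simp
  then show le: "k \<le> capacity I * replenishments I k q + q" by linarith
  have "?Q * real (replenishments I k q) \<le> max 0 (?Q * ?x + ?Q)"
  proof (cases "\<lceil>?x\<rceil> \<le> 0")
    case True
    then show ?thesis using psi by simp
  next
    case False
    then have "real (replenishments I k q) \<le> ?x + 1" using psi by linarith
    then have "?Q * real (replenishments I k q) \<le> ?Q * (?x + 1)" using Q by (intro mult_left_mono) auto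
    then show ?thesis by (simp add: distrib_left)
  qed
  then have "real (capacity I * replenishments I k q) \<le> max 0 (real k - real q + ?Q)" using x by simp
  then show "remaining_load I k q \<le> capacity I"
    unfolding remaining_load_def using assms(2) by linarith
qed

record label =
  node :: nat
  rem_load :: real
  part_route :: "nat list"
  apriori_cost :: real
  exp_cost :: "nat \<Rightarrow> real"
  dual_contrib :: real
  forbidden :: "nat set"

definition root_label :: "'w vrpsd_data \<Rightarrow> nat \<Rightarrow> label" where
  "root_label I j =
     \<lparr> node = j,
       rem_load = load_factor I * real (capacity I) - mean_demand I j,
       part_route = [j, 0],
       apriori_cost = cost I j 0,
       exp_cost = (\<lambda>q. cost I j 0),
       dual_contrib = gamma_dual I j 0,
       forbidden = {j} \<rparr>"

text \<open>
  Expected cost incurred from the arrival at the current node of \<open>L\<close> with remaining quantity \<open>q\<close>;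
  this series occurs in both the recursion for \<open>\<nu>\<close> and the reduced cost.
\<close>

definition service_cost :: "'w vrpsd_data \<Rightarrow> label \<Rightarrow> nat \<Rightarrow> real" where
  "service_cost I L q =
     (\<Sum>k. ((cost I (node L) 0 + cost I 0 (node L)) * real (replenishments I k q)
            + exp_cost L (remaining_load I k q)) * demand_pmf I (node L) k)"

definition extend :: "'w vrpsd_data \<Rightarrow> nat \<Rightarrow> label \<Rightarrow> label" where
  "extend I i L =
     \<lparr> node = i,
       rem_load = rem_load L - mean_demand I i,
       part_route = [i] @ part_route L,
       apriori_cost = apriori_cost L + cost I i (node L),
       exp_cost = (\<lambda>q. min (cost I i (node L) + service_cost I L q)
                           (cost I i 0 + cost I 0 (node L) + service_cost I L (capacity I))),
       dual_contrib = dual_contrib L + gamma_dual I i (node L),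
       forbidden = (forbidden L \<inter> ng_neighbours I i) \<union> {i} \<rparr>"

definition ng_feasible_step :: "'w vrpsd_data \<Rightarrow> nat \<Rightarrow> label \<Rightarrow> bool" where
  "ng_feasible_step I i L \<longleftrightarrow>
     i \<in> customers I \<and> mean_demand I i \<le> rem_load L \<and> i \<notin> forbidden L"

text \<open>Extensions are backward: the last element of the sequence is added first.\<close>

definition extend_seq :: "'w vrpsd_data \<Rightarrow> nat list \<Rightarrow> label \<Rightarrow> label" where
  "extend_seq I e L = foldr (extend I) e L"

primrec ng_feasible_extension :: "'w vrpsd_data \<Rightarrow> nat list \<Rightarrow> label \<Rightarrow> bool" where
  "ng_feasible_extension I [] L \<longleftrightarrow> True"
| "ng_feasible_extension I (i # e) L \<longleftrightarrow>
     ng_feasible_extension I e L \<and> ng_feasible_step I i (extend_seq I e L)"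

inductive is_label :: "'w vrpsd_data \<Rightarrow> label \<Rightarrow> bool" for I where
  root: "j \<in> customers I \<Longrightarrow> mean_demand I j \<le> load_factor I * real (capacity I) \<Longrightarrow>
         is_label I (root_label I j)"
| extension: "is_label I L \<Longrightarrow> ng_feasible_step I i L \<Longrightarrow> is_label I (extend I i L)"

definition ng_feasible_route :: "'w vrpsd_data \<Rightarrow> nat list \<Rightarrow> bool" where
  "ng_feasible_route I r \<longleftrightarrow> (\<exists>L. is_label I L \<and> r = [0] @ part_route L)"

definition label_reduced_cost :: "'w vrpsd_data \<Rightarrow> label \<Rightarrow> real" where
  "label_reduced_cost I L =
     cost I 0 (node L) + service_cost I L (capacity I) + dual_contrib L + gamma_dual I 0 (node L)"

text \<open>
  The reduced cost is a function of the route. It is well defined on ng-feasible routes because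
  the partial route determines the label, see \<open>reduced_cost_part_route\<close> below.
\<close>

definition reduced_cost :: "'w vrpsd_data \<Rightarrow> nat list \<Rightarrow> real" where
  "reduced_cost I r =
     (THE c. \<exists>L. is_label I L \<and> r = [0] @ part_route L \<and> c = label_reduced_cost I L)"

lemma part_route_simps [simp]:
  "part_route (root_label I j) = [j, 0]"
  "part_route (extend I i L) = i # part_route L"
  by (simp_all add: root_label_def extend_def)

lemma is_label_part_route_length: "is_label I L \<Longrightarrow> 2 \<le> length (part_route L)"
  by (induction rule: is_label.induct) auto

lemma root_part_route_neq_extend: "is_label I M \<Longrightarrow> [j, 0] \<noteq> i # part_route M"
  using is_label_part_route_length[of I M] by (cases "part_route M") auto

lemma is_label_eqI:
  assumes "is_label I L" "is_label I L'" "part_route L = part_route L'"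
  shows "L = L'"
  using assms
proof (induction arbitrary: L' rule: is_label.induct)
  case (root j)
  from root.prems(1) show ?case
  proof cases
    case (root j')
    then show ?thesis using \<open>part_route (root_label I j) = part_route L'\<close> by simp
  next
    case (extension M i)
    then show ?thesis
      using \<open>part_route (root_label I j) = part_route L'\<close> root_part_route_neq_extend[of I M j i] by simp
  qed
next
  case (extension L i)
  note IH = extension.IH and L = extension.hyps(1) and eq = extension.prems(2)
  from extension.prems(1) show ?case
  proof cases
    case (root j)
    then show ?thesis using eq root_part_route_neq_extend[OF L, of j i] by simp
  next
    case (extension M i')
    then have "i = i'" "part_route L = part_route M" using eq by simp_all
    moreover have "L = M" using IH \<open>is_label I M\<close> \<open>part_route L = part_route M\<close> by blast
    ultimately show ?thesis using extension by simp
  qed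
qed

lemma reduced_cost_part_route:
  assumes "is_label I L"
  shows "reduced_cost I ([0] @ part_route L) = label_reduced_cost I L"
  unfolding reduced_cost_def using assms is_label_eqI by (intro the_equality) auto

definition dominates :: "'w vrpsd_data \<Rightarrow> label \<Rightarrow> label \<Rightarrow> bool" where
  "dominates I L1 L2 \<longleftrightarrow>
     node L1 = node L2 \<and> rem_load L1 \<ge> rem_load L2 \<and> forbidden L1 \<subseteq> forbidden L2 \<and>
     dual_contrib L1 \<le> dual_contrib L2 \<and> (\<forall>q \<le> capacity I. exp_cost L1 q \<le> exp_cost L2 q)"

end

theory Submission
  imports Defs
begin

text \<open>
  The recursion for \<open>\<nu>\<close> is monotone in the \<open>\<nu>\<close> of the extended label, so dominance is preserved by
  single-customer extensions and hence by \<open>e\<close>. Monotonicity of the series needs their convergence: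
  \<open>\<nu>\<close> is only evaluated on the finite set \<open>{0..Q}\<close>, where it is bounded, and \<open>\<Psi>(k, q) \<le> k\<close>, so the
  finite mean of the demand provides a summable majorant.
\<close>

text \<open>The partial sums are the expectations of \<open>g (X \<omega>)\<close> restricted to the
  events \<open>X < n\<close>, so the full expectation bounds them all.\<close>

lemma (in prob_space) summable_nat_distribution:
  fixes X :: "'a \<Rightarrow> nat" and g :: "nat \<Rightarrow> real"
  assumes X [measurable]: "X \<in> measurable M (count_space UNIV)"
    and g: "integrable M (\<lambda>\<omega>. g (X \<omega>))" and nonneg: "\<And>k. 0 \<le> g k"
  shows "summable (\<lambda>k. g k * prob {\<omega> \<in> space M. X \<omega> = k})"
proof (rule summableI_nonneg_bounded)
  fix n
  let ?A = "\<lambda>k. {\<omega> \<in> space M. X \<omega> = k}"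
  have int: "integrable M (\<lambda>\<omega>. g k * indicator (?A k) \<omega>)" for k
    by (intro integrable_mult_right integrable_real_indicator) (auto simp: emeasure_eq_measure)
  have "(\<Sum>k<n. g k * prob (?A k)) = (\<Sum>k<n. \<integral>\<omega>. g k * indicator (?A k) \<omega> \<partial>M)"
    by (intro sum.cong) auto
  also have "\<dots> = (\<integral>\<omega>. (\<Sum>k<n. g k * indicator (?A k) \<omega>) \<partial>M)"
    by (intro Bochner_Integration.integral_sum [symmetric] int)
  also have "\<dots> \<le> (\<integral>\<omega>. g (X \<omega>) \<partial>M)"
  proof (intro integral_mono g Bochner_Integration.integrable_sum int)
    fix \<omega> assume "\<omega> \<in> space M"
    \<comment> \<open>At most one term survives: the sum is \<open>g (X \<omega>)\<close> if
      \<open>X \<omega> < n\<close>, and 0 otherwise.\<close>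
    then have "(\<Sum>k<n. g k * indicator (?A k) \<omega>) = (\<Sum>k<n. if k = X \<omega> then g k else 0)"
      by (intro sum.cong) (auto simp: indicator_def)
    then show "(\<Sum>k<n. g k * indicator (?A k) \<omega>) \<le> g (X \<omega>)"
      using nonneg by simp
  qed
  finally show "(\<Sum>k<n. g k * prob (?A k)) \<le> (\<integral>\<omega>. g (X \<omega>) \<partial>M)" .
qed (use nonneg in simp)

lemma is_label_node: "is_label I L \<Longrightarrow> node L \<in> customers I"
  by (induction rule: is_label.induct) (auto simp: root_label_def extend_def ng_feasible_step_def)

lemma part_route_extend_seq: "part_route (extend_seq I e L) = e @ part_route L"
  by (induction e) (auto simp: extend_seq_def)

lemma is_label_extend_seq:
  "is_label I L \<Longrightarrow> ng_feasible_extension I e L \<Longrightarrow> is_label I (extend_seq I e L)"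
  by (induction e) (auto simp: extend_seq_def intro: is_label.extension)

lemma ng_feasible_step_mono:
  "dominates I L1 L2 \<Longrightarrow> ng_feasible_step I i L2 \<Longrightarrow> ng_feasible_step I i L1"
  unfolding dominates_def ng_feasible_step_def by force

context vrpsd
begin

text \<open>Dropping \<open>q\<close> only enlarges the quotient, and the capacity is at least 1.
  This crude linear bound suffices because demands have finite mean.\<close>

lemma replenishments_le: "replenishments I k q \<le> k"
proof -
  have "(real k - real q) / real (capacity I) \<le> real k / real (capacity I)"
    using capacity_pos by (intro divide_right_mono) auto
  also have "\<dots> \<le> real k / 1"
    using capacity_pos by (intro divide_left_mono) auto
  finally show ?thesis
    unfolding replenishments_def by (simp add: nat_le_iff ceiling_le_iff)
qed

lemma summable_service_cost:
  assumes i: "i \<in> customers I" and q: "q \<le> capacity I"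
  shows "summable (\<lambda>k. (c * real (replenishments I k q) + \<nu> (remaining_load I k q)) * demand_pmf I i k)"
proof -
  \<comment> \<open>A bound for \<open>\<nu>\<close> at every remaining load, since these all lie in
    \<open>{0..Q}\<close>.\<close>
  define B where "B = (\<Sum>r\<le>capacity I. \<bar>\<nu> r\<bar>)"
  have B: "\<bar>\<nu> (remaining_load I k q)\<bar> \<le> B" for k
    unfolding B_def using remaining_load_exact(2) [OF capacity_pos q]
    by (intro member_le_sum) auto
  have "demand I i \<in> measurable (prob_sp I) (count_space UNIV)"
    using demand_indep i by (auto simp: indep_vars_def)
  moreover have "0 \<le> B" by (simp add: B_def sum_nonneg)
  ultimately have summable: "summable (\<lambda>k. (\<bar>c\<bar> * real k + B) * demand_pmf I i k)"
    unfolding demand_pmf_def using demand_integrable [OF i]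
    by (intro summable_nat_distribution) auto
  show ?thesis
  proof (rule summable_comparison_test' [OF summable])
    fix k
    have "\<bar>c * real (replenishments I k q) + \<nu> (remaining_load I k q)\<bar>
        \<le> \<bar>c\<bar> * real (replenishments I k q) + B"
      using B [of k] abs_triangle_ineq [of "c * real (replenishments I k q)" "\<nu> (remaining_load I k q)"]
      by (simp add: abs_mult)
    also have "\<dots> \<le> \<bar>c\<bar> * real k + B"
      using replenishments_le [of k q] by (intro add_right_mono mult_left_mono) auto
    finally show "norm ((c * real (replenishments I k q) + \<nu> (remaining_load I k q)) * demand_pmf I i k)
        \<le> (\<bar>c\<bar> * real k + B) * demand_pmf I i k"
      by (auto simp: abs_mult demand_pmf_def intro: mult_right_mono)
  qed
qed

text \<open>Both series have the same weights and trip costs because the nodes agree, so they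
  compare term by term. \<open>suminf_le\<close> requires both to be summable.\<close>

lemma service_cost_mono:
  assumes "dominates I L1 L2" "node L1 \<in> customers I" "q \<le> capacity I"
  shows "service_cost I L1 q \<le> service_cost I L2 q"
proof -
  have node: "node L2 = node L1"
    using assms(1) by (simp add: dominates_def)
  have le: "exp_cost L1 (remaining_load I k q) \<le> exp_cost L2 (remaining_load I k q)" for k
    using assms(1) remaining_load_exact(2) [OF capacity_pos assms(3)] by (simp add: dominates_def)
  show ?thesis
    unfolding service_cost_def node
    using assms(2,3)
    by (intro suminf_le summable_service_cost mult_right_mono add_left_mono le)
      (auto simp: demand_pmf_def)
qed

text \<open>With equal nodes, both labels change by the same load, cost and dual terms; intersecting
  with the ng-set and taking the minimum are monotone.\<close>

lemma dominates_extend: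
  assumes "dominates I L1 L2" "node L1 \<in> customers I"
  shows "dominates I (extend I i L1) (extend I i L2)"
proof -
  have "service_cost I L1 q \<le> service_cost I L2 q" if "q \<le> capacity I" for q
    using service_cost_mono assms that by blast
  then show ?thesis
    using assms(1) unfolding dominates_def extend_def by (auto intro: min.coboundedI1 min.coboundedI2)
qed

text \<open>The head of the list is added last, so list induction follows the order of extension.
  Feasibility and dominance are carried together: feasibility makes the extended \<open>L1\<close> a
  label, and dominance makes the next step feasible for it.\<close>

lemma dominates_extend_seq:
  assumes "is_label I L1" "dominates I L1 L2" "ng_feasible_extension I e L2"
  shows "ng_feasible_extension I e L1 \<and> dominates I (extend_seq I e L1) (extend_seq I e L2)"
  using assms(3)
proof (induction e)
  case Nil
  then show ?case using assms(2) by (simp add: extend_seq_def)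
next
  case (Cons i e)
  then have e: "ng_feasible_extension I e L1"
    and dom: "dominates I (extend_seq I e L1) (extend_seq I e L2)"
    by auto
  \<comment> \<open>Finite mean demand, and so convergence of the series, is available only at
    customers.\<close>
  have "node (extend_seq I e L1) \<in> customers I"
    using is_label_node is_label_extend_seq assms(1) e by blast
  then have "dominates I (extend_seq I (i # e) L1) (extend_seq I (i # e) L2)"
    using dominates_extend [OF dom] by (simp add: extend_seq_def)
  then show ?case
    using e ng_feasible_step_mono [OF dom] Cons.prems by auto
qed

lemma label_reduced_cost_mono:
  assumes "dominates I L1 L2" "node L1 \<in> customers I"
  shows "label_reduced_cost I L1 \<le> label_reduced_cost I L2"
  using service_cost_mono [OF assms order_refl] assms(1)
  by (simp add: label_reduced_cost_def dominates_def)

end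

theorem proposition2:
  fixes I :: "'w vrpsd_data" and L1 L2 :: label and e :: "nat list"
  assumes "vrpsd I"
    and "is_label I L1" and "is_label I L2"
    and "dominates I L1 L2"
    and "set e \<subseteq> customers I"
    and "ng_feasible_extension I e L2"
  shows "ng_feasible_route I ([0] @ e @ part_route L1) \<and>
         reduced_cost I ([0] @ e @ part_route L1) \<le> reduced_cost I ([0] @ e @ part_route L2)"
proof -
  interpret vrpsd I by fact
  let ?E1 = "extend_seq I e L1" and ?E2 = "extend_seq I e L2"
  have feas: "ng_feasible_extension I e L1" and dom: "dominates I ?E1 ?E2"
    using dominates_extend_seq assms by blast+
  have E1: "is_label I ?E1" and E2: "is_label I ?E2"
    using is_label_extend_seq assms feas by blast+
  have "ng_feasible_route I ([0] @ part_route ?E1)"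
    using E1 unfolding ng_feasible_route_def by blast
  \<comment> \<open>The definite description in \<open>reduced_cost\<close> can be evaluated because
    both extended labels are genuine labels, each determined by its partial route.\<close>
  moreover have "reduced_cost I ([0] @ part_route ?E1) \<le> reduced_cost I ([0] @ part_route ?E2)"
    unfolding reduced_cost_part_route [OF E1] reduced_cost_part_route [OF E2]
    using label_reduced_cost_mono dom is_label_node [OF E1] by blast
  ultimately show ?thesis
    by (simp only: part_route_extend_seq)
qed

end
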